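(* Let $Y$ be a real Banach space and let $A:\ell^1\to Y$ be an injective and sequentially weak*-to-weak continuous bounded linear operator with adjoint $A^\ast:Y^\ast\to\ell^\infty$. Then for each $\mu\in(0,1)$ there is a real sequence $(\gamma_n)_{n\in\mathbb N}$ such that the following holds: for each $n\in\mathbb N$ and each $\xi\in\ell^\infty$ with $\xi_k\in\{-1,0,1\}$ for $k\le n$ and $\xi_k=0$ for $k>n$, there exists some $\eta\in Y^\ast$ such that (i) $P_nA^\ast\eta=\xi$, (ii) $|[(I-P_n)A^\ast\eta]_k|\le\mu$ for all $k>n$, (iii) $\|\eta\|_{Y^\ast}\le\gamma_n$.
   Context: $\ell^1$ is the space of absolutely summable real sequences, regarded as the dual of $c_0$ (real sequences converging to zero); this defines weak* convergence in $\ell^1$. $A$ is sequentially weak*-to-weak continuous if it maps weak*-convergent sequences in $\ell^1$ to weakly convergent sequences in $Y$ (with the image of the limit as limit). $\ell^\infty=(\ell^1)^\ast$ is the space of bounded real sequences, and $P_n:\ell^\infty\to\ell^\infty$, $P_nx:=(x_1,\ldots,x_n,0,0,\ldots)$, is the cut-off after the $n$-th entry; $\mathbb N=\{1,2,\ldots\}$. *)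

theory Defs
  imports "HOL-Analysis.Analysis"
begin

text \<open>
  Sequences are indexed from \<open>0\<close>: the mathematical entry \<open>x\<^sub>k\<close>, \<open>k = 1, 2, \<dots>\<close>, is \<open>x (k - 1)\<close>.
  Hence the entries \<open>k \<le> n\<close> are those at positions \<open>k < n\<close>, and the entries \<open>k > n\<close> those
  at positions \<open>k \<ge> n\<close>.
\<close>

section \<open>The Banach space of absolutely summable real sequences\<close>

typedef ell1 = "{x :: nat \<Rightarrow> real. summable (\<lambda>k. \<bar>x k\<bar>)}"
  morphisms apply_ell1 Abs_ell1
  by (rule exI[of _ "\<lambda>_. 0"]) simp

declare [[coercion apply_ell1]]

setup_lifting type_definition_ell1

lemma summable_abs_ell1: "summable (\<lambda>k. \<bar>apply_ell1 x k\<bar>)"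
  using apply_ell1[of x] by simp

lemma ell1_eqI: "(\<And>k. apply_ell1 x k = apply_ell1 y k) \<Longrightarrow> x = y"
  by transfer auto

instantiation ell1 :: real_vector
begin

lift_definition zero_ell1 :: ell1 is "\<lambda>_. 0"
  by simp

lift_definition plus_ell1 :: "ell1 \<Rightarrow> ell1 \<Rightarrow> ell1" is "\<lambda>x y k. x k + y k"
proof -
  fix x y :: "nat \<Rightarrow> real"
  assume "summable (\<lambda>k. \<bar>x k\<bar>)" "summable (\<lambda>k. \<bar>y k\<bar>)"
  then have "summable (\<lambda>k. \<bar>x k\<bar> + \<bar>y k\<bar>)"
    by (rule summable_add)
  then show "summable (\<lambda>k. \<bar>x k + y k\<bar>)"
    by (rule summable_comparison_test[rotated]) (auto intro!: exI[of _ 0] abs_triangle_ineq)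
qed

lift_definition uminus_ell1 :: "ell1 \<Rightarrow> ell1" is "\<lambda>x k. - x k"
  by simp

lift_definition minus_ell1 :: "ell1 \<Rightarrow> ell1 \<Rightarrow> ell1" is "\<lambda>x y k. x k - y k"
proof -
  fix x y :: "nat \<Rightarrow> real"
  assume "summable (\<lambda>k. \<bar>x k\<bar>)" "summable (\<lambda>k. \<bar>y k\<bar>)"
  then have "summable (\<lambda>k. \<bar>x k\<bar> + \<bar>y k\<bar>)"
    by (rule summable_add)
  then show "summable (\<lambda>k. \<bar>x k - y k\<bar>)"
    by (rule summable_comparison_test[rotated]) (auto intro!: exI[of _ 0] abs_triangle_ineq4)
qed

lift_definition scaleR_ell1 :: "real \<Rightarrow> ell1 \<Rightarrow> ell1" is "\<lambda>c x k. c * x k"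
  by (simp add: abs_mult summable_mult)

instance
  by standard (transfer, simp add: fun_eq_iff algebra_simps)+

end

lemmas ell1_simps [simp] =
  zero_ell1.rep_eq plus_ell1.rep_eq uminus_ell1.rep_eq minus_ell1.rep_eq scaleR_ell1.rep_eq

instantiation ell1 :: real_normed_vector
begin

definition norm_ell1 :: "ell1 \<Rightarrow> real"
  where "norm_ell1 x = (\<Sum>k. \<bar>apply_ell1 x k\<bar>)"

definition dist_ell1 :: "ell1 \<Rightarrow> ell1 \<Rightarrow> real"
  where "dist_ell1 x y = norm (x - y)"

definition sgn_ell1 :: "ell1 \<Rightarrow> ell1"
  where "sgn_ell1 x = x /\<^sub>R norm x"

definition uniformity_ell1 :: "(ell1 \<times> ell1) filter"
  where "uniformity_ell1 = (INF e\<in>{0 <..}. principal {(x, y). dist x y < e})"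

definition open_ell1 :: "ell1 set \<Rightarrow> bool"
  where "open_ell1 S = (\<forall>x\<in>S. \<forall>\<^sub>F (x', y) in uniformity. x' = x \<longrightarrow> y \<in> S)"

instance
proof
  fix x y :: ell1 and c :: real
  show "dist x y = norm (x - y)"
    by (rule dist_ell1_def)
  show "sgn x = x /\<^sub>R norm x"
    by (rule sgn_ell1_def)
  show "uniformity = (INF e\<in>{0 <..}. principal {(x :: ell1, y). dist x y < e})"
    by (rule uniformity_ell1_def)
  show "open S = (\<forall>x\<in>S. \<forall>\<^sub>F (x', y) in uniformity. x' = x \<longrightarrow> y \<in> S)" for S :: "ell1 set"
    by (rule open_ell1_def)
  show "norm x = 0 \<longleftrightarrow> x = 0"
  proof
    assume "norm x = 0"
    then have "\<forall>k. \<bar>apply_ell1 x k\<bar> = 0"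
      using suminf_eq_zero_iff[OF summable_abs_ell1, of x] by (simp add: norm_ell1_def)
    then show "x = 0"
      by (intro ell1_eqI) simp
  qed (simp add: norm_ell1_def)
  have "norm (x + y) \<le> (\<Sum>k. \<bar>apply_ell1 x k\<bar> + \<bar>apply_ell1 y k\<bar>)"
    unfolding norm_ell1_def
    by (intro suminf_le summable_abs_ell1 summable_add) (simp add: abs_triangle_ineq)
  also have "\<dots> = norm x + norm y"
    unfolding norm_ell1_def by (intro suminf_add[symmetric] summable_abs_ell1)
  finally show "norm (x + y) \<le> norm x + norm y" .
  show "norm (c *\<^sub>R x) = \<bar>c\<bar> * norm x"
    unfolding norm_ell1_def by (simp add: abs_mult suminf_mult summable_abs_ell1)
qed

end

lemma sum_abs_le_norm_ell1: "(\<Sum>k<n. \<bar>apply_ell1 x k\<bar>) \<le> norm x"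
  unfolding norm_ell1_def by (intro sum_le_suminf summable_abs_ell1) auto

lemma abs_le_norm_ell1: "\<bar>apply_ell1 x k\<bar> \<le> norm x"
proof -
  have "\<bar>apply_ell1 x k\<bar> \<le> (\<Sum>j<Suc k. \<bar>apply_ell1 x j\<bar>)"
    by (simp add: sum_nonneg)
  also have "\<dots> \<le> norm x"
    by (rule sum_abs_le_norm_ell1)
  finally show ?thesis .
qed

instance ell1 :: banach
proof
  fix X :: "nat \<Rightarrow> ell1"
  assume X: "Cauchy X"
  have "Cauchy (\<lambda>m. apply_ell1 (X m) k)" for k
  proof (rule metric_CauchyI)
    fix e :: real assume "0 < e"
    from metric_CauchyD[OF X this] obtain M
      where M: "\<And>m n. m \<ge> M \<Longrightarrow> n \<ge> M \<Longrightarrow> norm (X m - X n) < e"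
      by (auto simp: dist_norm)
    have "dist (apply_ell1 (X m) k) (apply_ell1 (X n) k) < e" if "m \<ge> M" "n \<ge> M" for m n
      using M[OF that] abs_le_norm_ell1[of "X m - X n" k] by (simp add: dist_real_def)
    then show "\<exists>M. \<forall>m\<ge>M. \<forall>n\<ge>M. dist (apply_ell1 (X m) k) (apply_ell1 (X n) k) < e"
      by blast
  qed
  then have "\<forall>k. \<exists>l. (\<lambda>m. apply_ell1 (X m) k) \<longlonglongrightarrow> l"
    by (simp add: Cauchy_convergent_iff convergent_def)
  then obtain l where l: "\<And>k. (\<lambda>m. apply_ell1 (X m) k) \<longlonglongrightarrow> l k"
    by metis
  have *: "\<exists>M. \<forall>m\<ge>M. \<forall>K. (\<Sum>k<K. \<bar>apply_ell1 (X m) k - l k\<bar>) \<le> e" if "0 < e" for e :: real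
  proof -
    from metric_CauchyD[OF X that] obtain M
      where M: "\<And>m n. m \<ge> M \<Longrightarrow> n \<ge> M \<Longrightarrow> norm (X m - X n) < e"
      by (auto simp: dist_norm)
    have "(\<Sum>k<K. \<bar>apply_ell1 (X m) k - l k\<bar>) \<le> e" if "m \<ge> M" for m K
    proof (rule LIMSEQ_le_const2)
      show "(\<lambda>n. \<Sum>k<K. \<bar>apply_ell1 (X m) k - apply_ell1 (X n) k\<bar>)
          \<longlonglongrightarrow> (\<Sum>k<K. \<bar>apply_ell1 (X m) k - l k\<bar>)"
        by (intro tendsto_intros l)
      have "(\<Sum>k<K. \<bar>apply_ell1 (X m) k - apply_ell1 (X n) k\<bar>) \<le> e" if "n \<ge> M" for n
        using sum_abs_le_norm_ell1[of "X m - X n" K] M[OF \<open>m \<ge> M\<close> that] by simp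
      then show "\<exists>N. \<forall>n\<ge>N. (\<Sum>k<K. \<bar>apply_ell1 (X m) k - apply_ell1 (X n) k\<bar>) \<le> e"
        by blast
    qed
    then show ?thesis
      by blast
  qed
  have diff: "summable (\<lambda>k. \<bar>apply_ell1 (X m) k - l k\<bar>)"
    if "\<forall>K. (\<Sum>k<K. \<bar>apply_ell1 (X m) k - l k\<bar>) \<le> e" for m e
    using that by (intro summableI_nonneg_bounded[where x = e]) auto
  obtain M where M: "\<forall>K. (\<Sum>k<K. \<bar>apply_ell1 (X M) k - l k\<bar>) \<le> 1"
    using *[of 1] by auto
  have "summable (\<lambda>k. \<bar>apply_ell1 (X M) k\<bar> + \<bar>apply_ell1 (X M) k - l k\<bar>)"
    by (intro summable_add summable_abs_ell1 diff[OF M])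
  then have "summable (\<lambda>k. \<bar>l k\<bar>)"
    by (rule summable_comparison_test[rotated]) (auto intro!: exI[of _ 0])
  then obtain L where L: "\<And>k. apply_ell1 L k = l k"
    by (metis Abs_ell1_inverse mem_Collect_eq)
  have "X \<longlonglongrightarrow> L"
  proof (rule metric_LIMSEQ_I)
    fix e :: real assume "0 < e"
    then obtain N where N: "\<forall>m\<ge>N. \<forall>K. (\<Sum>k<K. \<bar>apply_ell1 (X m) k - l k\<bar>) \<le> e / 2"
      using *[of "e / 2"] by auto
    have "dist (X m) L < e" if "m \<ge> N" for m
    proof -
      have "norm (X m - L) \<le> e / 2"
        unfolding norm_ell1_def using N that by (intro suminf_le_const summable_abs_ell1) (simp add: L)
      then show ?thesis
        using \<open>0 < e\<close> by (simp add: dist_norm)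
    qed
    then show "\<exists>N. \<forall>m\<ge>N. dist (X m) L < e"
      by blast
  qed
  then show "convergent X"
    by (rule convergentI)
qed

lift_definition unit_ell1 :: "nat \<Rightarrow> ell1" is "\<lambda>k j. if j = k then 1 else 0"
proof -
  fix k :: nat
  show "summable (\<lambda>j. \<bar>if j = k then 1 else 0 :: real\<bar>)"
    by (rule summable_finite[of "{k}"]) auto
qed

lemma norm_unit_ell1 [simp]: "norm (unit_ell1 k) = 1"
  unfolding norm_ell1_def unit_ell1.rep_eq
  by (subst suminf_finite[of "{k}"]) auto

lemma sums_unit_ell1: "(\<lambda>k. apply_ell1 x k *\<^sub>R unit_ell1 k) sums x"
  unfolding sums_def
proof (rule metric_LIMSEQ_I)
  fix e :: real assume "0 < e"
  have nth: "apply_ell1 (\<Sum>k<n. apply_ell1 x k *\<^sub>R unit_ell1 k) j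
      = (if j < n then apply_ell1 x j else 0)" for n j
    by (induction n) (auto simp: unit_ell1.rep_eq less_Suc_eq)
  have norm: "norm ((\<Sum>k<n. apply_ell1 x k *\<^sub>R unit_ell1 k) - x) = (\<Sum>k. \<bar>apply_ell1 x (k + n)\<bar>)"
    for n
  proof -
    have "norm ((\<Sum>k<n. apply_ell1 x k *\<^sub>R unit_ell1 k) - x)
        = (\<Sum>k. \<bar>(if k < n then apply_ell1 x k else 0) - apply_ell1 x k\<bar>)"
      unfolding norm_ell1_def by (simp add: nth)
    also have "\<dots> = (\<Sum>k. \<bar>(if k + n < n then apply_ell1 x (k + n) else 0) - apply_ell1 x (k + n)\<bar>)"
    proof (subst suminf_split_initial_segment[where k = n])
      show "summable (\<lambda>k. \<bar>(if k < n then apply_ell1 x k else 0) - apply_ell1 x k\<bar>)"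
        by (rule summable_comparison_test[OF _ summable_abs_ell1[of x]]) auto
    qed simp
    finally show ?thesis
      by simp
  qed
  from suminf_exist_split[OF \<open>0 < e\<close>, of "\<lambda>k. \<bar>apply_ell1 x k\<bar>"]
  obtain N where N: "\<And>n. n \<ge> N \<Longrightarrow> \<bar>\<Sum>k. \<bar>apply_ell1 x (k + n)\<bar>\<bar> < e"
    using summable_abs_ell1 by auto
  have "dist (\<Sum>k<n. apply_ell1 x k *\<^sub>R unit_ell1 k) x < e" if "n \<ge> N" for n
    using N[OF that] by (simp add: dist_norm norm)
  then show "\<exists>N. \<forall>n\<ge>N. dist (\<Sum>k<n. apply_ell1 x k *\<^sub>R unit_ell1 k) x < e"
    by blast
qed


section \<open>Bounded sequences as the dual space\<close>

text \<open>Every function on the discrete space \<^typ>\<open>nat\<close> is continuous, so the following is the space of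
  all bounded sequences with the supremum norm.\<close>

type_synonym ellinf = "nat \<Rightarrow>\<^sub>C real"

lemma mem_bcontfun_nat: "(x :: nat \<Rightarrow> real) \<in> bcontfun \<longleftrightarrow> bounded (range x)"
  by (simp add: bcontfun_def)

unbundle bcontfun.lifting

lift_definition cut_off :: "nat \<Rightarrow> ellinf \<Rightarrow> ellinf" is "\<lambda>n x k. if k < n then x k else 0"
proof -
  fix n :: nat and x :: "nat \<Rightarrow> real"
  assume "x \<in> bcontfun"
  then obtain b where "\<And>k. \<bar>x k\<bar> \<le> b"
    by (auto simp: bcontfun_def bounded_iff)
  then have "\<bar>x k\<bar> \<le> \<bar>b\<bar>" for k
    by (meson abs_ge_self order_trans)
  then show "(\<lambda>k. if k < n then x k else 0) \<in> bcontfun"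
    by (intro bcontfun_normI[where b = "\<bar>b\<bar>"]) auto
qed

lift_definition ellinf_of_dual :: "(ell1 \<Rightarrow>\<^sub>L real) \<Rightarrow> ellinf"
  is "\<lambda>f k. blinfun_apply f (unit_ell1 k)"
proof -
  fix f :: "ell1 \<Rightarrow>\<^sub>L real"
  show "(\<lambda>k. f (unit_ell1 k)) \<in> bcontfun"
  proof (rule bcontfun_normI)
    show "norm (f (unit_ell1 k)) \<le> norm f" for k
      using norm_blinfun[of f "unit_ell1 k"] by simp
  qed simp
qed

lifting_forget bcontfun.lifting

text \<open>The map \<^const>\<open>ellinf_of_dual\<close> is the usual isometric identification of the dual of \<^typ>\<open>ell1\<close>
  with \<^typ>\<open>ellinf\<close>: the sequence represents the functional through the pairing
  \<open>\<Sum>k. z\<^sub>k x\<^sub>k\<close>.\<close>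

lemma ellinf_of_dual_sums:
  "(\<lambda>k. ellinf_of_dual f k * apply_ell1 x k) sums blinfun_apply f x"
  using bounded_linear.sums[OF blinfun.bounded_linear_right sums_unit_ell1, of f x]
  by (simp add: ellinf_of_dual.rep_eq blinfun.scaleR_right mult.commute)

lemma summable_pairing: "summable (\<lambda>k. \<bar>(z :: ellinf) k * apply_ell1 x k\<bar>)"
proof (rule summable_comparison_test)
  show "\<exists>N. \<forall>k\<ge>N. norm \<bar>z k * apply_ell1 x k\<bar> \<le> norm z * \<bar>apply_ell1 x k\<bar>"
    using norm_bounded[of z] by (auto simp: abs_mult intro!: mult_right_mono)
  show "summable (\<lambda>k. norm z * \<bar>apply_ell1 x k\<bar>)"
    by (intro summable_mult summable_abs_ell1)
qed

lemma abs_pairing_le: "\<bar>\<Sum>k. (z :: ellinf) k * apply_ell1 x k\<bar> \<le> norm z * norm x"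
proof -
  have "\<bar>\<Sum>k. z k * apply_ell1 x k\<bar> \<le> (\<Sum>k. \<bar>z k * apply_ell1 x k\<bar>)"
    by (rule summable_rabs[OF summable_pairing])
  also have "\<dots> \<le> (\<Sum>k. norm z * \<bar>apply_ell1 x k\<bar>)"
    using norm_bounded[of z]
    by (intro suminf_le summable_pairing summable_mult summable_abs_ell1)
      (auto simp: abs_mult intro!: mult_right_mono)
  also have "\<dots> = norm z * norm x"
    unfolding norm_ell1_def by (intro suminf_mult summable_abs_ell1)
  finally show ?thesis .
qed

lemma norm_ellinf_of_dual: "norm (ellinf_of_dual f) = norm f"
proof (rule antisym)
  show "norm (ellinf_of_dual f) \<le> norm f"
    using norm_blinfun[of f "unit_ell1 _"]
    by (intro norm_bound) (simp add: ellinf_of_dual.rep_eq)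
  show "norm f \<le> norm (ellinf_of_dual f)"
  proof (rule norm_blinfun_bound)
    show "norm (f x) \<le> norm (ellinf_of_dual f) * norm x" for x
      using abs_pairing_le[of "ellinf_of_dual f" x] sums_unique[OF ellinf_of_dual_sums, of f x]
      by simp
  qed simp
qed

lemma linear_ellinf_of_dual: "linear ellinf_of_dual"
  by (rule linearI)
    (auto intro!: bcontfun_eqI simp: ellinf_of_dual.rep_eq blinfun.add_left blinfun.scaleR_left)

lemma bij_ellinf_of_dual: "bij ellinf_of_dual"
proof (rule bijI)
  show "inj ellinf_of_dual"
    unfolding linear_injective_0[OF linear_ellinf_of_dual]
    using norm_ellinf_of_dual by (metis norm_eq_zero)
  show "surj ellinf_of_dual"
    unfolding surj_def
  proof
    fix z :: ellinf
    have summable: "summable (\<lambda>k. z k * apply_ell1 x k)" for x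
      by (rule summable_rabs_cancel[OF summable_pairing])
    have "bounded_linear (\<lambda>x. \<Sum>k. z k * apply_ell1 x k)"
    proof (rule bounded_linear_intro)
      show "(\<Sum>k. z k * apply_ell1 (x + y) k)
          = (\<Sum>k. z k * apply_ell1 x k) + (\<Sum>k. z k * apply_ell1 y k)" for x y
        by (simp add: suminf_add summable distrib_left)
      show "(\<Sum>k. z k * apply_ell1 (c *\<^sub>R x) k) = c *\<^sub>R (\<Sum>k. z k * apply_ell1 x k)" for c x
        by (simp add: suminf_mult[OF summable, symmetric] mult.left_commute)
      show "norm (\<Sum>k. z k * apply_ell1 x k) \<le> norm x * norm z" for x
        using abs_pairing_le[of z x] by (simp add: mult.commute)
    qed
    then obtain f where f: "\<And>x. blinfun_apply f x = (\<Sum>k. z k * apply_ell1 x k)"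
      by (metis bounded_linear_Blinfun_apply)
    have "ellinf_of_dual f = z"
    proof (rule bcontfun_eqI)
      fix k
      have "(\<Sum>j. z j * apply_ell1 (unit_ell1 k) j) = z k"
        by (subst suminf_finite[of "{k}"]) (auto simp: unit_ell1.rep_eq)
      then show "ellinf_of_dual f k = z k"
        by (simp add: ellinf_of_dual.rep_eq f)
    qed
    then show "\<exists>f. z = ellinf_of_dual f"
      by blast
  qed
qed


section \<open>Adjoint operators\<close>

definition dual_adjoint ::
  "('a::real_normed_vector \<Rightarrow>\<^sub>L 'b::real_normed_vector) \<Rightarrow> ('b \<Rightarrow>\<^sub>L real) \<Rightarrow> ('a \<Rightarrow>\<^sub>L real)"
  where "dual_adjoint A \<eta> = \<eta> o\<^sub>L A"

definition adjoint_ell1 :: "(ell1 \<Rightarrow>\<^sub>L 'b::real_normed_vector) \<Rightarrow> ('b \<Rightarrow>\<^sub>L real) \<Rightarrow> ellinf"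
  where "adjoint_ell1 A \<eta> = ellinf_of_dual (dual_adjoint A \<eta>)"

lemma adjoint_ell1_sums:
  "(\<lambda>k. adjoint_ell1 A \<eta> k * apply_ell1 x k) sums blinfun_apply \<eta> (blinfun_apply A x)"
  using ellinf_of_dual_sums[of "dual_adjoint A \<eta>" x] by (simp add: adjoint_ell1_def dual_adjoint_def)


section \<open>Weak and weak* convergence of sequences\<close>

text \<open>The space \<^typ>\<open>ell1\<close> is the dual of the space of null sequences via \<open>\<Sum>k. x\<^sub>k y\<^sub>k\<close>.\<close>

definition weak_star_tendsto :: "(nat \<Rightarrow> ell1) \<Rightarrow> ell1 \<Rightarrow> bool"
  where "weak_star_tendsto X x \<longleftrightarrow>
    (\<forall>y :: nat \<Rightarrow> real. y \<longlonglongrightarrow> 0 \<longrightarrow>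
      (\<lambda>m. \<Sum>k. apply_ell1 (X m) k * y k) \<longlonglongrightarrow> (\<Sum>k. apply_ell1 x k * y k))"

definition weak_tendsto :: "(nat \<Rightarrow> 'b::real_normed_vector) \<Rightarrow> 'b \<Rightarrow> bool"
  where "weak_tendsto Y y \<longleftrightarrow>
    (\<forall>\<eta> :: 'b \<Rightarrow>\<^sub>L real. (\<lambda>m. blinfun_apply \<eta> (Y m)) \<longlonglongrightarrow> blinfun_apply \<eta> y)"

definition seq_weak_star_to_weak_continuous :: "(ell1 \<Rightarrow> 'b::real_normed_vector) \<Rightarrow> bool"
  where "seq_weak_star_to_weak_continuous T \<longleftrightarrow>
    (\<forall>X x. weak_star_tendsto X x \<longrightarrow> weak_tendsto (\<lambda>m. T (X m)) (T x))"

end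

theory Submission
  imports Defs "HOL-Complex_Analysis.Great_Picard"
begin

text \<open>
  By the Hahn--Banach theorem, a functional \<open>\<eta>\<close> of norm at most \<open>c\<close> with
  \<open>\<eta> (A x) \<le> (\<Sum>k<n. \<xi>\<^sub>k x\<^sub>k) + \<mu> (\<Sum>k\<ge>n. \<bar>x\<^sub>k\<bar>)\<close> for all \<open>x\<close> exists as soon as the right-hand side is
  bounded below by \<open>- c \<parallel>A x\<parallel>\<close>; inserting \<open>\<plusminus>\<close> the unit vectors gives (i) and (ii).  The lower bound
  follows from \<open>(\<Sum>k<n. \<bar>x\<^sub>k\<bar>) \<le> c \<parallel>A x\<parallel> + \<mu> (\<Sum>k\<ge>n. \<bar>x\<^sub>k\<bar>)\<close>.  If this failed for every \<open>c\<close>, there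
  would be a bounded sequence with \<open>A x\<^sub>m \<rightarrow> 0\<close> and \<open>(\<Sum>k<n. \<bar>x\<^sub>m\<^sub>k\<bar>) = 1\<close>; a weak* limit of a
  subsequence would then be a nonzero element of the kernel of \<open>A\<close>.
\<close>

section \<open>The Hahn--Banach theorem for sublinear functionals\<close>

text \<open>The inequality in the second clause is automatically an equality.\<close>

definition sublinear :: "('a::real_vector \<Rightarrow> real) \<Rightarrow> bool"
  where "sublinear p \<longleftrightarrow> (\<forall>x y. p (x + y) \<le> p x + p y) \<and> (\<forall>c\<ge>0. \<forall>x. p (c *\<^sub>R x) \<le> c * p x)"

lemma sublinearI:
  assumes "\<And>x y. p (x + y) \<le> p x + p y" and "\<And>c x. 0 \<le> c \<Longrightarrow> p (c *\<^sub>R x) \<le> c * p x"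
  shows "sublinear p"
  using assms by (simp add: sublinear_def)

lemma sublinear_add: "sublinear p \<Longrightarrow> p (x + y) \<le> p x + p y"
  by (simp add: sublinear_def)

lemma sublinear_scaleR_le: "sublinear p \<Longrightarrow> 0 \<le> c \<Longrightarrow> p (c *\<^sub>R x) \<le> c * p x"
  by (simp add: sublinear_def)

lemma sublinear_0: "sublinear p \<Longrightarrow> p 0 = 0"
  using sublinear_add[of p 0 0] sublinear_scaleR_le[of p 0 0] by simp

lemma sublinear_scaleR:
  assumes "sublinear p" "0 \<le> c"
  shows "p (c *\<^sub>R x) = c * p x"
proof (cases "c = 0")
  case False
  with assms have "c > 0" by simp
  have "p ((1 / c) *\<^sub>R c *\<^sub>R x) \<le> (1 / c) * p (c *\<^sub>R x)"
    using assms by (intro sublinear_scaleR_le) auto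
  with \<open>c > 0\<close> have "c * p x \<le> p (c *\<^sub>R x)"
    by (simp add: field_simps)
  with sublinear_scaleR_le[OF assms, of x] show ?thesis
    by simp
qed (simp add: sublinear_0[OF assms(1)])

lemma sublinear_minus: "sublinear p \<Longrightarrow> - p (- x) \<le> p x"
  using sublinear_add[of p x "- x"] sublinear_0[of p] by simp

text \<open>Oddness turns the subadditivity estimate at \<open>- x\<close> and \<open>- y\<close>
  into the reverse estimate at \<open>x\<close> and \<open>y\<close>, and it extends homogeneity to
  negative scalars.\<close>

lemma sublinear_odd_linear:
  assumes p: "sublinear p" and odd: "\<And>x. p (- x) = - p x"
  shows "linear p"
proof (rule linearI)
  fix x y :: 'a and c :: real
  have "p (- x + - y) \<le> p (- x) + p (- y)"
    by (rule sublinear_add[OF p])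
  then show "p (x + y) = p x + p y"
    using sublinear_add[OF p, of x y] odd[of "x + y"] by (simp add: odd)
  show "p (c *\<^sub>R x) = c *\<^sub>R p x"
  proof (cases "0 \<le> c")
    case False
    then show ?thesis
      using sublinear_scaleR[OF p, of "- c" x] odd[of "c *\<^sub>R x"] by simp
  qed (simp add: sublinear_scaleR[OF p])
qed

text \<open>The index \<open>k\<close> may depend on the arguments. This form covers chains of
  functionals, where \<open>k\<close> is the smaller one, as well as infima over vectors or scalars,
  where \<open>k\<close> is a sum or a multiple.\<close>

lemma sublinear_INF:
  fixes p :: "'i \<Rightarrow> 'a::real_vector \<Rightarrow> real"
  assumes "I \<noteq> {}" and bdd: "\<And>x. bdd_below ((\<lambda>i. p i x) ` I)"
    and add: "\<And>i j x y. i \<in> I \<Longrightarrow> j \<in> I \<Longrightarrow> \<exists>k\<in>I. p k (x + y) \<le> p i x + p j y"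
    and scale: "\<And>i c x. i \<in> I \<Longrightarrow> 0 \<le> c \<Longrightarrow> \<exists>k\<in>I. p k (c *\<^sub>R x) \<le> c * p i x"
  shows "sublinear (\<lambda>x. INF i\<in>I. p i x)"
proof (rule sublinearI)
  have le: "(INF i\<in>I. p i x) \<le> p k x" if "k \<in> I" for k x
    by (rule cINF_lower[OF bdd that])
  show "(INF i\<in>I. p i (x + y)) \<le> (INF i\<in>I. p i x) + (INF i\<in>I. p i y)" for x y
  proof -
    \<comment> \<open>The two infima on the right are taken one after the other: first over
      \<open>j\<close> with \<open>i\<close> fixed, then over \<open>i\<close>.\<close>
    have *: "(INF i\<in>I. p i (x + y)) - p i x \<le> p j y" if "i \<in> I" "j \<in> I" for i j
    proof -
      have "(INF i\<in>I. p i (x + y)) \<le> p i x + p j y"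
        using add[OF that, of x y] le order_trans by meson
      then show ?thesis
        by simp
    qed
    have "(INF i\<in>I. p i (x + y)) - (INF j\<in>I. p j y) \<le> p i x" if "i \<in> I" for i
    proof -
      have "(INF i\<in>I. p i (x + y)) - p i x \<le> (INF j\<in>I. p j y)"
        using * that by (intro cINF_greatest \<open>I \<noteq> {}\<close>)
      then show ?thesis
        by simp
    qed
    then have "(INF i\<in>I. p i (x + y)) - (INF j\<in>I. p j y) \<le> (INF i\<in>I. p i x)"
      by (intro cINF_greatest \<open>I \<noteq> {}\<close>)
    then show ?thesis
      by simp
  qed
  show "(INF i\<in>I. p i (c *\<^sub>R x)) \<le> c * (INF i\<in>I. p i x)" if "0 \<le> c" for c x
  proof -
    have *: "(INF i\<in>I. p i (c *\<^sub>R x)) \<le> c * p i x" if "i \<in> I" for i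
      using scale[OF that \<open>0 \<le> c\<close>, of x] le order_trans by meson
    show ?thesis
    proof (cases "c = 0")
      \<comment> \<open>Division by \<open>c\<close> is impossible here; \<open>*\<close> at any
        single index already gives the bound 0.\<close>
      case True
      then show ?thesis
        using * \<open>I \<noteq> {}\<close> by auto
    next
      case False
      with that have "c > 0" by simp
      then have "(INF i\<in>I. p i (c *\<^sub>R x)) / c \<le> (INF i\<in>I. p i x)"
        using * by (intro cINF_greatest \<open>I \<noteq> {}\<close>) (simp add: field_simps)
      with \<open>c > 0\<close> show ?thesis
        by (simp add: field_simps)
    qed
  qed
qed

text \<open>For each \<open>y\<close> one builds a sublinear \<open>q\<close> below \<open>p\<close>
  with \<open>q (- y) \<le> - p y\<close>. Minimality gives \<open>q = p\<close>, so
  \<open>p\<close> is odd.\<close>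

lemma minimal_sublinear_linear:
  assumes p: "sublinear p" and min: "\<And>q. sublinear q \<Longrightarrow> q \<le> p \<Longrightarrow> q = p"
  shows "linear p"
proof (rule sublinear_odd_linear[OF p])
  fix y
  \<comment> \<open>The value \<open>t = 0\<close> gives \<open>q \<le> p\<close>; the value
    \<open>t = 1\<close> at \<open>- y\<close> gives the inequality that makes \<open>p\<close>
    odd.\<close>
  define q where "q x = (INF t\<in>{0..}. p (x + t *\<^sub>R y) - t * p y)" for x
  have bdd: "bdd_below ((\<lambda>t. p (x + t *\<^sub>R y) - t * p y) ` {0..})" for x
  proof (rule bdd_belowI2)
    show "- p (- x) \<le> p (x + t *\<^sub>R y) - t * p y" if "t \<in> {0..}" for t
      using sublinear_add[OF p, of "x + t *\<^sub>R y" "- x"] sublinear_scaleR[OF p, of t y] that by simp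
  qed
  have q_le: "q x \<le> p (x + t *\<^sub>R y) - t * p y" if "0 \<le> t" for x t
    unfolding q_def using that by (intro cINF_lower bdd) auto
  have "sublinear q"
    unfolding q_def
  proof (rule sublinear_INF[OF _ bdd])
    fix s t :: real and x z
    assume "s \<in> {0..}" "t \<in> {0..}"
    then show "\<exists>r\<in>{0..}. p (x + z + r *\<^sub>R y) - r * p y
        \<le> (p (x + s *\<^sub>R y) - s * p y) + (p (z + t *\<^sub>R y) - t * p y)"
      using sublinear_add[OF p, of "x + s *\<^sub>R y" "z + t *\<^sub>R y"]
      by (intro bexI[of _ "s + t"]) (auto simp: algebra_simps)
  next
    fix s c :: real and x
    assume "s \<in> {0..}" "0 \<le> c"
    then show "\<exists>r\<in>{0..}. p (c *\<^sub>R x + r *\<^sub>R y) - r * p y \<le> c * (p (x + s *\<^sub>R y) - s * p y)"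
      using sublinear_scaleR[OF p, of c "x + s *\<^sub>R y"]
      by (intro bexI[of _ "c * s"]) (auto simp: algebra_simps)
  qed simp
  moreover have "q \<le> p"
    using q_le[of 0] by (auto intro!: le_funI)
  ultimately have "q = p"
    by (rule min)
  then have "p (- y) \<le> p 0 - p y"
    using q_le[of 1 "- y"] by simp
  then show "p (- y) = - p y"
    using sublinear_minus[OF p, of y] sublinear_0[OF p] by simp
qed

lemma sublinear_dominates_linear:
  assumes p: "sublinear p"
  obtains f where "linear f" "\<And>x. f x \<le> p x"
proof -
  define S where "S = {q. sublinear q \<and> q \<le> p}"
  have "\<exists>m\<in>S. \<forall>a\<in>S. a \<le> m \<longrightarrow> a = m"
  proof (rule predicate_Zorn)
    \<comment> \<open>The order is reversed, so that Zorn's lemma yields a minimal element.\<close>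
    show "partial_order_on S (relation_of (\<lambda>a b. b \<le> a) S)"
      by (rule partial_order_on_relation_ofI) auto
  next
    fix C
    assume "C \<in> Chains (relation_of (\<lambda>a b. b \<le> a) S)"
    then have "C \<subseteq> S" and chain: "\<And>a b. a \<in> C \<Longrightarrow> b \<in> C \<Longrightarrow> a \<le> b \<or> b \<le> a"
      by (auto simp: Chains_def relation_of_def)
    show "\<exists>u\<in>S. \<forall>a\<in>C. u \<le> a"
    proof (cases "C = {}")
      case True
      then show ?thesis
        using p by (auto simp: S_def)
    next
      case False
      have sub: "sublinear q" "q x \<le> p x" if "q \<in> C" for q x
        using that \<open>C \<subseteq> S\<close> by (auto simp: S_def le_fun_def)
      have bdd: "bdd_below ((\<lambda>q. q x) ` C)" for x
      proof (rule bdd_belowI2)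
        \<comment> \<open>Since \<open>q \<le> p\<close>,
          \<open>- p (- x) \<le> - q (- x) \<le> q x\<close>, a bound that is uniform over the
          chain.\<close>
        show "- p (- x) \<le> q x" if "q \<in> C" for q
          using sublinear_minus[OF sub(1)[OF that], of x] sub(2)[OF that, of "- x"] by simp
      qed
      define u where "u x = (INF q\<in>C. q x)" for x
      have lower: "u \<le> q" if "q \<in> C" for q
        unfolding u_def using that by (auto intro!: le_funI cINF_lower bdd)
      have "sublinear u"
        unfolding u_def
      proof (rule sublinear_INF[OF False bdd])
        show "\<exists>k\<in>C. k (x + y) \<le> q x + r y" if "q \<in> C" "r \<in> C" for q r x y
          using chain[OF that]
        proof
          assume "q \<le> r"
          then have "q (x + y) \<le> q x + r y"
            using sublinear_add[OF sub(1)[OF that(1)], of x y] le_funD[of q r y] by simp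
          with that show ?thesis by blast
        next
          assume "r \<le> q"
          then have "r (x + y) \<le> q x + r y"
            using sublinear_add[OF sub(1)[OF that(2)], of x y] le_funD[of r q x] by simp
          with that show ?thesis by blast
        qed
        show "\<exists>k\<in>C. k (c *\<^sub>R x) \<le> c * q x" if "q \<in> C" "0 \<le> c" for q c x
          using sublinear_scaleR_le[OF sub(1)[OF that(1)] that(2)] that by blast
      qed
      moreover obtain q where "q \<in> C"
        using False by blast
      then have "u \<le> p"
        using lower[of q] sub(2)[of q] by (auto simp: le_fun_def intro: order_trans)
      ultimately show ?thesis
        using lower by (auto simp: S_def)
    qed
  qed
  then obtain m where m: "sublinear m" "m \<le> p"
    and min: "\<And>a. sublinear a \<Longrightarrow> a \<le> p \<Longrightarrow> a \<le> m \<Longrightarrow> a = m"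
    by (auto simp: S_def)
  \<comment> \<open>A sublinear functional below \<open>m\<close> is also below \<open>p\<close>, so
    \<open>m\<close> is minimal among all sublinear functionals.\<close>
  have "linear m"
    using m min by (intro minimal_sublinear_linear) (auto intro: order_trans)
  with m that show ?thesis
    by (auto simp: le_fun_def)
qed

section \<open>Norm-controlled functionals dominated on the range of a linear map\<close>

text \<open>The infimal convolution \<open>p\<close> of \<open>c * norm\<close> with the image of
  \<open>q\<close> under \<open>T\<close> is sublinear on the codomain. It lies below
  \<open>c * norm\<close> (take \<open>x = 0\<close>) and satisfies
  \<open>p (T x) \<le> q x\<close>, so any linear functional below \<open>p\<close> meets both
  demands.\<close>

lemma bounded_functional_dominated_on_range:
  fixes T :: "'a::real_vector \<Rightarrow> 'b::real_normed_vector"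
  assumes T: "linear T" and q: "sublinear q" and c: "\<And>x. - q x \<le> c * norm (T x)" "0 \<le> c"
  obtains \<eta> :: "'b \<Rightarrow>\<^sub>L real" where "\<And>x. \<eta> (T x) \<le> q x" "norm \<eta> \<le> c"
proof -
  define p where "p y = (INF x. c * norm (y - T x) + q x)" for y
  \<comment> \<open>The lower bound on \<open>q\<close> in terms of \<open>norm (T x)\<close> is
    what keeps the infimum finite.\<close>
  have bdd: "bdd_below (range (\<lambda>x. c * norm (y - T x) + q x))" for y
  proof (rule bdd_belowI2)
    fix x
    have "norm (T x) \<le> norm (y - T x) + norm y"
      by (metis norm_minus_commute norm_triangle_sub add.commute)
    then have "c * norm (T x) \<le> c * norm (y - T x) + c * norm y"
      using c(2) by (metis distrib_left mult_left_mono)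
    then show "- c * norm y \<le> c * norm (y - T x) + q x"
      using c(1)[of x] by simp
  qed
  have p_le: "p y \<le> c * norm (y - T x) + q x" for x y
    unfolding p_def by (intro cINF_lower bdd) auto
  have "sublinear p"
    unfolding p_def
  proof (rule sublinear_INF[OF _ bdd])
    fix x z :: 'a and y w :: 'b
    have "norm (y + w - T (x + z)) \<le> norm (y - T x) + norm (w - T z)"
      using norm_triangle_ineq[of "y - T x" "w - T z"] by (simp add: linear_add[OF T] algebra_simps)
    then have "c * norm (y + w - T (x + z)) \<le> c * norm (y - T x) + c * norm (w - T z)"
      using c(2) by (metis distrib_left mult_left_mono)
    then have "c * norm (y + w - T (x + z)) + q (x + z)
        \<le> (c * norm (y - T x) + q x) + (c * norm (w - T z) + q z)"
      using sublinear_add[OF q, of x z] by simp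
    then show "\<exists>k\<in>UNIV. c * norm (y + w - T k) + q k
        \<le> (c * norm (y - T x) + q x) + (c * norm (w - T z) + q z)"
      by blast
  next
    fix x :: 'a and y :: 'b and s :: real
    assume "0 \<le> s"
    then have "norm (s *\<^sub>R y - T (s *\<^sub>R x)) = s * norm (y - T x)"
      by (simp add: linear_scale[OF T] flip: scaleR_diff_right)
    with \<open>0 \<le> s\<close> have "c * norm (s *\<^sub>R y - T (s *\<^sub>R x)) + q (s *\<^sub>R x) \<le> s * (c * norm (y - T x) + q x)"
      using sublinear_scaleR[OF q, of s x] by (simp add: algebra_simps)
    then show "\<exists>k\<in>UNIV. c * norm (s *\<^sub>R y - T k) + q k \<le> s * (c * norm (y - T x) + q x)"
      by blast
  qed simp
  then obtain f where f: "linear f" "\<And>y. f y \<le> p y"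
    by (rule sublinear_dominates_linear) blast
  have le: "f y \<le> c * norm y" for y
    using f(2)[of y] p_le[of y 0] by (simp add: linear_0[OF T] sublinear_0[OF q])
  \<comment> \<open>The one-sided bound at \<open>y\<close> and at \<open>- y\<close> is a two-sided
    one.\<close>
  have norm_le: "norm (f y) \<le> c * norm y" for y
    using le[of y] le[of "- y"] by (simp add: linear_neg[OF f(1)])
  have "bounded_linear f"
    using norm_le f(1)
    by (intro bounded_linear_intro[where K = c]) (auto simp: linear_add linear_scale mult.commute)
  then obtain \<eta> where \<eta>: "\<And>y. blinfun_apply \<eta> y = f y"
    by (metis bounded_linear_Blinfun_apply)
  show ?thesis
  proof
    show "\<eta> (T x) \<le> q x" for x
      using f(2)[of "T x"] p_le[of "T x" x] by (simp add: \<eta>)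
    show "norm \<eta> \<le> c"
      using norm_le c(2) by (intro norm_blinfun_bound) (auto simp: \<eta>)
  qed
qed

text \<open>The functionals separate points: dominate on the line through \<open>y\<close> with the
  linear \<open>q t = t * norm y\<close> and \<open>c = 1\<close>.\<close>

lemma bounded_functional_nonzero:
  fixes y :: "'b::real_normed_vector"
  assumes "y \<noteq> 0"
  obtains \<eta> :: "'b \<Rightarrow>\<^sub>L real" where "\<eta> y \<noteq> 0"
proof -
  have "linear (\<lambda>t::real. t *\<^sub>R y)"
    by (rule linearI) (auto simp: algebra_simps)
  moreover have "sublinear (\<lambda>t. t * norm y)"
    by (rule sublinearI) (auto simp: algebra_simps)
  moreover have "- (t * norm y) \<le> 1 * norm (t *\<^sub>R y)" for t :: real
    using mult_right_mono[of "- t" "\<bar>t\<bar>" "norm y"] by simp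
  ultimately obtain \<eta> :: "'b \<Rightarrow>\<^sub>L real" where \<eta>: "\<And>t. \<eta> (t *\<^sub>R y) \<le> t * norm y"
    by (rule bounded_functional_dominated_on_range) auto
  \<comment> \<open>A negative \<open>t\<close> reverses the domination and yields a lower bound for
    \<open>\<eta> y\<close>.\<close>
  from \<eta>[of "- 1"] have "\<eta> y \<ge> norm y"
    by (simp add: blinfun.minus_right)
  with assms have "\<eta> y \<noteq> 0"
    by auto
  then show ?thesis
    by (rule that)
qed

section \<open>Weak* sequential compactness in the space of summable sequences\<close>

definition tail_norm :: "nat \<Rightarrow> ell1 \<Rightarrow> real"
  where "tail_norm n x = (\<Sum>k. \<bar>apply_ell1 x (k + n)\<bar>)"

lemma summable_tail_ell1: "summable (\<lambda>k. \<bar>apply_ell1 x (k + n)\<bar>)"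
  by (rule summable_ignore_initial_segment[OF summable_abs_ell1])

lemma tail_norm_nonneg: "0 \<le> tail_norm n x"
  unfolding tail_norm_def by (intro suminf_nonneg summable_tail_ell1) simp

lemma tail_norm_scaleR: "tail_norm n (c *\<^sub>R x) = \<bar>c\<bar> * tail_norm n x"
  unfolding tail_norm_def by (simp add: abs_mult suminf_mult summable_tail_ell1)

lemma tail_norm_triangle: "tail_norm n (x + y) \<le> tail_norm n x + tail_norm n y"
proof -
  have "tail_norm n (x + y) \<le> (\<Sum>k. \<bar>apply_ell1 x (k + n)\<bar> + \<bar>apply_ell1 y (k + n)\<bar>)"
    unfolding tail_norm_def
    by (intro suminf_le summable_tail_ell1 summable_add) (simp add: abs_triangle_ineq)
  also have "\<dots> = tail_norm n x + tail_norm n y"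
    unfolding tail_norm_def by (intro suminf_add[symmetric] summable_tail_ell1)
  finally show ?thesis .
qed

lemma norm_ell1_split: "norm x = (\<Sum>k<n. \<bar>apply_ell1 x k\<bar>) + tail_norm n x"
  unfolding norm_ell1_def tail_norm_def
  using suminf_split_initial_segment[OF summable_abs_ell1, of x n] by simp

lemma tail_norm_unit_ell1: "tail_norm n (unit_ell1 k) = (if k < n then 0 else 1)"
  using norm_ell1_split[of "unit_ell1 k" n] by (auto simp: unit_ell1.rep_eq if_distrib cong: if_cong)

text \<open>Beyond some \<open>n\<close> the null sequence \<open>y\<close> is small, so the norm
  bound makes the tails of the pairings uniformly small; the heads are finite sums and converge
  entrywise.\<close>

lemma weak_star_tendstoI:
  fixes X :: "nat \<Rightarrow> ell1"
  assumes bdd: "\<And>m. norm (X m) \<le> b" and lim: "\<And>k. (\<lambda>m. apply_ell1 (X m) k) \<longlonglongrightarrow> apply_ell1 x k"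
  shows "weak_star_tendsto X x"
  unfolding weak_star_tendsto_def
proof (intro allI impI)
  fix y :: "nat \<Rightarrow> real"
  assume y: "y \<longlonglongrightarrow> 0"
  have b: "0 \<le> b"
    using bdd[of 0] norm_ge_zero order_trans by blast
  obtain B where B: "\<And>k. \<bar>y k\<bar> \<le> B"
    using convergent_imp_Bseq[OF convergentI[OF y]] by (auto simp: Bseq_def)
  have sum: "summable (\<lambda>k. \<bar>apply_ell1 z k * y k\<bar>)" for z
  proof (rule summable_comparison_test)
    show "\<exists>N. \<forall>k\<ge>N. norm \<bar>apply_ell1 z k * y k\<bar> \<le> \<bar>apply_ell1 z k\<bar> * B"
      using B by (auto simp: abs_mult intro!: mult_left_mono)
    show "summable (\<lambda>k. \<bar>apply_ell1 z k\<bar> * B)"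
      by (intro summable_mult2 summable_abs_ell1)
  qed
  have split: "\<bar>\<Sum>k. apply_ell1 z k * y k\<bar> \<le> \<bar>\<Sum>k<n. apply_ell1 z k * y k\<bar> + norm z * e"
    if "\<And>k. k \<ge> n \<Longrightarrow> \<bar>y k\<bar> \<le> e" for z n e
  proof -
    have e: "0 \<le> e"
      using that[of n] by simp
    have sum': "summable (\<lambda>k. \<bar>apply_ell1 z (k + n) * y (k + n)\<bar>)"
      using summable_ignore_initial_segment[OF sum, of z n] by simp
    have "\<bar>\<Sum>k. apply_ell1 z (k + n) * y (k + n)\<bar> \<le> (\<Sum>k. \<bar>apply_ell1 z (k + n) * y (k + n)\<bar>)"
      by (rule summable_rabs[OF sum'])
    also have "\<dots> \<le> (\<Sum>k. \<bar>apply_ell1 z (k + n)\<bar> * e)"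
      using that
      by (intro suminf_le sum' summable_mult2 summable_tail_ell1)
        (auto simp: abs_mult intro!: mult_left_mono)
    also have "\<dots> = tail_norm n z * e"
      unfolding tail_norm_def by (intro suminf_mult2[symmetric] summable_tail_ell1)
    also have "\<dots> \<le> norm z * e"
      using norm_ell1_split[of z n] e by (intro mult_right_mono) (auto simp: sum_nonneg)
    finally show ?thesis
      using suminf_split_initial_segment[OF summable_rabs_cancel[OF sum[of z]], of n] by simp
  qed
  have diff: "(\<Sum>k. apply_ell1 (X m) k * y k) - (\<Sum>k. apply_ell1 x k * y k)
      = (\<Sum>k. apply_ell1 (X m - x) k * y k)" for m
    using suminf_diff[OF summable_rabs_cancel[OF sum] summable_rabs_cancel[OF sum], of "X m" x]
    by (simp add: left_diff_distrib)
  have nX: "norm (X m - x) \<le> b + norm x" for m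
    using norm_triangle_ineq4[of "X m" x] bdd[of m] by simp
  show "(\<lambda>m. \<Sum>k. apply_ell1 (X m) k * y k) \<longlonglongrightarrow> (\<Sum>k. apply_ell1 x k * y k)"
  proof (rule metric_LIMSEQ_I)
    fix e :: real
    assume "0 < e"
    \<comment> \<open>Half of \<open>e\<close> is reserved for the tail, whose size is at most
      \<open>(b + norm x) * d\<close>; the summand 1 keeps the denominator positive.\<close>
    define d where "d = e / (2 * (b + norm x + 1))"
    have pos: "0 < b + norm x + 1"
      using b norm_ge_zero[of x] by linarith
    have "0 < d"
      unfolding d_def using \<open>0 < e\<close> pos by simp
    have "(b + norm x + 1) * d = e / 2"
      unfolding d_def using pos by (simp add: field_simps)
    then have d: "(b + norm x) * d \<le> e / 2"
      using \<open>0 < d\<close> by (simp add: algebra_simps)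
    obtain n where n: "\<And>k. k \<ge> n \<Longrightarrow> \<bar>y k\<bar> \<le> d"
      using LIMSEQ_D[OF y \<open>0 < d\<close>] by (auto intro: less_imp_le)
    have "(\<lambda>m. \<Sum>k<n. apply_ell1 (X m - x) k * y k) \<longlonglongrightarrow> (\<Sum>k<n. (apply_ell1 x k - apply_ell1 x k) * y k)"
      unfolding ell1_simps by (intro tendsto_intros lim)
    then have "(\<lambda>m. \<Sum>k<n. apply_ell1 (X m - x) k * y k) \<longlonglongrightarrow> 0"
      by simp
    from LIMSEQ_D[OF this, of "e / 2"] \<open>0 < e\<close> obtain M
      where M: "\<And>m. m \<ge> M \<Longrightarrow> \<bar>\<Sum>k<n. apply_ell1 (X m - x) k * y k\<bar> < e / 2"
      by auto
    have "dist (\<Sum>k. apply_ell1 (X m) k * y k) (\<Sum>k. apply_ell1 x k * y k) < e" if "m \<ge> M" for m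
    proof -
      have "\<bar>\<Sum>k. apply_ell1 (X m - x) k * y k\<bar>
          \<le> \<bar>\<Sum>k<n. apply_ell1 (X m - x) k * y k\<bar> + norm (X m - x) * d"
        using n by (rule split)
      moreover have "norm (X m - x) * d \<le> (b + norm x) * d"
        using nX \<open>0 < d\<close> by (intro mult_right_mono) auto
      ultimately show ?thesis
        using M[OF that] d by (simp only: dist_real_def diff)
    qed
    then show "\<exists>M. \<forall>m\<ge>M. dist (\<Sum>k. apply_ell1 (X m) k * y k) (\<Sum>k. apply_ell1 x k * y k) < e"
      by blast
  qed
qed

text \<open>Sequential Banach-Alaoglu for the dual of the null sequences: a diagonal subsequence
  converges in every entry. The entrywise limits are returned too, since they carry finite sums of
  absolute values to the limit.\<close>

lemma bounded_ell1_weak_star_subsequence: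
  fixes X :: "nat \<Rightarrow> ell1"
  assumes bdd: "\<And>m. norm (X m) \<le> b"
  obtains r x where "strict_mono r" "weak_star_tendsto (\<lambda>m. X (r m)) x"
    "\<And>k. (\<lambda>m. apply_ell1 (X (r m)) k) \<longlonglongrightarrow> apply_ell1 x k"
proof -
  have entry_le: "norm (apply_ell1 (X m) k) \<le> b" for m k
    using abs_le_norm_ell1[of "X m" k] bdd[of m] by simp
  obtain r where r: "strict_mono r" and "\<And>k. \<exists>l. (\<lambda>m. apply_ell1 (X (r m)) k) \<longlonglongrightarrow> l"
    using function_convergent_subsequence[of UNIV "\<lambda>m. apply_ell1 (X m)" b, OF _ entry_le]
    by (metis UNIV_I countableI_type)
  then obtain l where l: "\<And>k. (\<lambda>m. apply_ell1 (X (r m)) k) \<longlonglongrightarrow> l k"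
    by metis
  \<comment> \<open>Bounds on finite partial sums survive the entrywise limit, so \<open>l\<close>
    is absolutely summable.\<close>
  have "(\<Sum>k<K. \<bar>l k\<bar>) \<le> b" for K
  proof (rule LIMSEQ_le_const2)
    show "(\<lambda>m. \<Sum>k<K. \<bar>apply_ell1 (X (r m)) k\<bar>) \<longlonglongrightarrow> (\<Sum>k<K. \<bar>l k\<bar>)"
      by (intro tendsto_intros l)
    show "\<exists>N. \<forall>m\<ge>N. (\<Sum>k<K. \<bar>apply_ell1 (X (r m)) k\<bar>) \<le> b"
      using sum_abs_le_norm_ell1 bdd order_trans by blast
  qed
  then have "summable (\<lambda>k. \<bar>l k\<bar>)"
    by (intro summableI_nonneg_bounded[where x = b]) auto
  then obtain x where "\<And>k. apply_ell1 x k = l k"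
    by (metis Abs_ell1_inverse mem_Collect_eq)
  with l have lim: "(\<lambda>m. apply_ell1 (X (r m)) k) \<longlonglongrightarrow> apply_ell1 x k" for k
    by simp
  show ?thesis
    using r weak_star_tendstoI[of "\<lambda>m. X (r m)", OF bdd lim] lim by (rule that)
qed

section \<open>Controlling finitely many entries by the image\<close>

text \<open>The compactness argument gives no formula for \<open>c\<close>. The tail term, with
  \<open>\<mu> > 0\<close>, keeps normalized counterexamples bounded.\<close>

lemma initial_segment_le_image_plus_tail:
  fixes A :: "ell1 \<Rightarrow>\<^sub>L 'b::real_normed_vector"
  assumes inj: "inj (blinfun_apply A)"
    and cont: "seq_weak_star_to_weak_continuous (blinfun_apply A)"
    and \<mu>: "0 < \<mu>"
  obtains c where "0 \<le> c" "\<And>x. (\<Sum>k<n. \<bar>apply_ell1 x k\<bar>) \<le> c * norm (A x) + \<mu> * tail_norm n x"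
proof (rule ccontr)
  assume "\<not> thesis"
  \<comment> \<open>One counterexample for each constant \<open>m\<close>.\<close>
  have "\<exists>x. real m * norm (A x) + \<mu> * tail_norm n x < (\<Sum>k<n. \<bar>apply_ell1 x k\<bar>)" for m
    using that[of "real m"] \<open>\<not> thesis\<close> by (meson not_le of_nat_0_le_iff)
  then obtain Z where Z: "\<And>m. real m * norm (A (Z m)) + \<mu> * tail_norm n (Z m) < (\<Sum>k<n. \<bar>apply_ell1 (Z m) k\<bar>)"
    by metis
  define s where "s m = (\<Sum>k<n. \<bar>apply_ell1 (Z m) k\<bar>)" for m
  have s: "0 < s m" for m
  proof -
    have "0 \<le> real m * norm (A (Z m)) + \<mu> * tail_norm n (Z m)"
      using \<mu> tail_norm_nonneg by simp
    with Z[of m] show ?thesis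
      unfolding s_def by linarith
  qed
  \<comment> \<open>Both sides are positively homogeneous, so the head can be scaled to exactly
    1.\<close>
  define X where "X m = (1 / s m) *\<^sub>R Z m" for m
  have X1: "(\<Sum>k<n. \<bar>apply_ell1 (X m) k\<bar>) = 1" for m
    using s[of m] by (simp add: X_def abs_mult flip: sum_divide_distrib) (simp add: s_def)
  have Xlt: "real m * norm (A (X m)) + \<mu> * tail_norm n (X m) < 1" for m
  proof -
    have "real m * norm (A (X m)) + \<mu> * tail_norm n (X m)
        = (real m * norm (A (Z m)) + \<mu> * tail_norm n (Z m)) / s m"
      using s[of m] by (simp add: X_def blinfun.scaleR_right tail_norm_scaleR add_divide_distrib)
    also have "\<dots> < 1"
      using Z[of m] s[of m] by (simp add: s_def)
    finally show ?thesis .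
  qed
  \<comment> \<open>The head contributes 1 and the tail at most \<open>1 / \<mu>\<close>.\<close>
  have "norm (X m) \<le> 1 + 1 / \<mu>" for m
  proof -
    have "0 \<le> real m * norm (A (X m))"
      by simp
    then have "\<mu> * tail_norm n (X m) \<le> 1"
      using Xlt[of m] by linarith
    then show ?thesis
      using norm_ell1_split[of "X m" n] X1[of m] \<mu> by (simp add: field_simps)
  qed
  then obtain r x where r: "strict_mono r" and weak: "weak_star_tendsto (\<lambda>m. X (r m)) x"
    and lim: "\<And>k. (\<lambda>m. apply_ell1 (X (r m)) k) \<longlonglongrightarrow> apply_ell1 x k"
    by (rule bounded_ell1_weak_star_subsequence[of X]) blast+
  have "(\<lambda>m. A (X m)) \<longlonglongrightarrow> 0"
  proof (rule tendsto_norm_zero_cancel, rule tendsto_sandwich)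
    show "\<forall>\<^sub>F m in sequentially. 0 \<le> norm (A (X m))"
      by simp
    show "\<forall>\<^sub>F m in sequentially. norm (A (X m)) \<le> 1 / real m"
    proof (rule eventually_sequentiallyI[of 1])
      fix m :: nat
      assume "1 \<le> m"
      moreover have "0 \<le> \<mu> * tail_norm n (X m)"
        using \<mu> tail_norm_nonneg by simp
      with Xlt[of m] have "real m * norm (A (X m)) \<le> 1"
        by linarith
      ultimately show "norm (A (X m)) \<le> 1 / real m"
        by (simp add: field_simps)
    qed
  qed (auto intro: lim_1_over_n)
  then have null: "(\<lambda>m. A (X (r m))) \<longlonglongrightarrow> 0"
    using LIMSEQ_subseq_LIMSEQ[OF _ r] by (fastforce simp: o_def)
  \<comment> \<open>The images converge weakly to \<open>A x\<close> and in norm to 0, and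
    functionals separate these limits.\<close>
  have "A x = 0"
  proof (rule ccontr)
    assume "A x \<noteq> 0"
    then obtain \<eta> :: "'b \<Rightarrow>\<^sub>L real" where \<eta>: "\<eta> (A x) \<noteq> 0"
      by (rule bounded_functional_nonzero)
    have "(\<lambda>m. \<eta> (A (X (r m)))) \<longlonglongrightarrow> \<eta> (A x)"
      using cont weak unfolding seq_weak_star_to_weak_continuous_def weak_tendsto_def by blast
    moreover have "(\<lambda>m. \<eta> (A (X (r m)))) \<longlonglongrightarrow> \<eta> 0"
      by (intro tendsto_intros null)
    ultimately show False
      using \<eta> LIMSEQ_unique by (metis blinfun.zero_right)
  qed
  then have "x = 0"
    using inj by (metis blinfun.zero_right injD)
  \<comment> \<open>The head involves finitely many entries, so its value 1 passes to the limit,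
    whereas \<open>x = 0\<close> has head 0.\<close>
  moreover have "(\<lambda>m. \<Sum>k<n. \<bar>apply_ell1 (X (r m)) k\<bar>) \<longlonglongrightarrow> (\<Sum>k<n. \<bar>apply_ell1 x k\<bar>)"
    by (intro tendsto_intros lim)
  ultimately show False
    by (simp add: X1 LIMSEQ_const_iff)
qed

section \<open>Prescribing the first entries of the adjoint image\<close>

lemma adjoint_interpolation:
  fixes A :: "ell1 \<Rightarrow>\<^sub>L 'b::real_normed_vector"
  assumes c: "0 \<le> c" "\<And>x. (\<Sum>k<n. \<bar>apply_ell1 x k\<bar>) \<le> c * norm (A x) + \<mu> * tail_norm n x"
    and \<mu>: "0 < \<mu>" and \<xi>: "\<And>k. k < n \<Longrightarrow> \<bar>\<xi> k\<bar> \<le> 1"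
  obtains \<eta> :: "'b \<Rightarrow>\<^sub>L real" where "norm \<eta> \<le> c"
    "\<And>k. k < n \<Longrightarrow> adjoint_ell1 A \<eta> k = \<xi> k" "\<And>k. n \<le> k \<Longrightarrow> \<bar>adjoint_ell1 A \<eta> k\<bar> \<le> \<mu>"
proof -
  define q where "q x = (\<Sum>k<n. \<xi> k * apply_ell1 x k) + \<mu> * tail_norm n x" for x
  have "sublinear q"
  proof (rule sublinearI)
    fix x y :: ell1 and s :: real
    have "\<mu> * tail_norm n (x + y) \<le> \<mu> * tail_norm n x + \<mu> * tail_norm n y"
      using \<mu> tail_norm_triangle[of n x y] by (simp flip: distrib_left)
    then show "q (x + y) \<le> q x + q y"
      by (simp add: q_def algebra_simps sum.distrib)
    show "q (s *\<^sub>R x) \<le> s * q x" if "0 \<le> s"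
      using that by (simp add: q_def tail_norm_scaleR algebra_simps sum_distrib_left)
  qed
  \<comment> \<open>As \<open>\<bar>\<xi> k\<bar> \<le> 1\<close>, \<open>- q x\<close> is at most
    the head minus \<open>\<mu>\<close> times the tail norm, which the assumption on
    \<open>c\<close> bounds.\<close>
  moreover have "- q x \<le> c * norm (A x)" for x
  proof -
    have "- (\<Sum>k<n. \<xi> k * apply_ell1 x k) \<le> (\<Sum>k<n. \<bar>apply_ell1 x k\<bar>)"
      unfolding sum_negf[symmetric]
    proof (rule sum_mono)
      fix k assume "k \<in> {..<n}"
      then have "\<bar>\<xi> k * apply_ell1 x k\<bar> \<le> 1 * \<bar>apply_ell1 x k\<bar>"
        unfolding abs_mult using \<xi> by (intro mult_right_mono) auto
      then show "- (\<xi> k * apply_ell1 x k) \<le> \<bar>apply_ell1 x k\<bar>"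
        by simp
    qed
    then show ?thesis
      using c(2)[of x] by (simp add: q_def)
  qed
  ultimately obtain \<eta> :: "'b \<Rightarrow>\<^sub>L real" where \<eta>: "\<And>x. \<eta> (A x) \<le> q x" "norm \<eta> \<le> c"
    using bounded_functional_dominated_on_range[of "blinfun_apply A" q c]
      bounded_linear.linear[OF blinfun.bounded_linear_right, of A] c(1) by blast
  have adj: "adjoint_ell1 A \<eta> k = \<eta> (A (unit_ell1 k))" for k
    by (simp add: adjoint_ell1_def ellinf_of_dual.rep_eq dual_adjoint_def)
  \<comment> \<open>Along a unit vector \<open>q\<close> is linear for \<open>k < n\<close>, which
    forces equality, and equals \<open>\<mu> * \<bar>s\<bar>\<close> otherwise, which gives a
    two-sided bound; \<open>s = 1\<close> and \<open>s = -1\<close> suffice.\<close>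
  have q_unit: "q (s *\<^sub>R unit_ell1 k) = (if k < n then s * \<xi> k else \<bar>s\<bar> * \<mu>)" for s k
    by (auto simp: q_def tail_norm_scaleR tail_norm_unit_ell1 unit_ell1.rep_eq if_distrib cong: if_cong)
  have up: "adjoint_ell1 A \<eta> k \<le> (if k < n then \<xi> k else \<mu>)" for k
    using \<eta>(1)[of "1 *\<^sub>R unit_ell1 k"] unfolding q_unit by (simp add: adj split: if_splits)
  have low: "- adjoint_ell1 A \<eta> k \<le> (if k < n then - \<xi> k else \<mu>)" for k
    using \<eta>(1)[of "(-1) *\<^sub>R unit_ell1 k"] unfolding q_unit
    by (simp add: adj blinfun.minus_right split: if_splits)
  show ?thesis
  proof
    show "norm \<eta> \<le> c" by fact
    show "adjoint_ell1 A \<eta> k = \<xi> k" if "k < n" for k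
      using up[of k] low[of k] that by simp
    show "\<bar>adjoint_ell1 A \<eta> k\<bar> \<le> \<mu>" if "n \<le> k" for k
      using up[of k] low[of k] that by simp
  qed
qed

theorem corollary10:
  fixes A :: "ell1 \<Rightarrow>\<^sub>L 'b::banach"
  assumes "inj (blinfun_apply A)"
    and "seq_weak_star_to_weak_continuous (blinfun_apply A)"
  shows "\<forall>\<mu>::real. 0 < \<mu> \<and> \<mu> < 1 \<longrightarrow>
    (\<exists>\<gamma> :: nat \<Rightarrow> real. \<forall>n\<ge>1. \<forall>\<xi> :: ellinf.
      (\<forall>k<n. apply_bcontfun \<xi> k \<in> {-1, 0, 1}) \<and> (\<forall>k\<ge>n. apply_bcontfun \<xi> k = 0) \<longrightarrow>
      (\<exists>\<eta> :: 'b \<Rightarrow>\<^sub>L real.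
        cut_off n (adjoint_ell1 A \<eta>) = \<xi> \<and>
        (\<forall>k\<ge>n. \<bar>apply_bcontfun (adjoint_ell1 A \<eta> - cut_off n (adjoint_ell1 A \<eta>)) k\<bar> \<le> \<mu>) \<and>
        norm \<eta> \<le> \<gamma> n))"
proof (intro allI impI)
  fix \<mu> :: real
  assume "0 < \<mu> \<and> \<mu> < 1"
  then have \<mu>: "0 < \<mu>" by simp
  \<comment> \<open>The constant is fixed before \<open>\<xi>\<close> appears, so
    \<open>\<gamma> n\<close> serves all sign patterns of length \<open>n\<close> at once.\<close>
  have "\<exists>c\<ge>0. \<forall>x. (\<Sum>k<n. \<bar>apply_ell1 x k\<bar>) \<le> c * norm (A x) + \<mu> * tail_norm n x" for n
    by (rule initial_segment_le_image_plus_tail[OF assms \<mu>, of n]) blast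
  then obtain \<gamma> where \<gamma>: "\<And>n. 0 \<le> \<gamma> n"
    "\<And>n x. (\<Sum>k<n. \<bar>apply_ell1 x k\<bar>) \<le> \<gamma> n * norm (A x) + \<mu> * tail_norm n x"
    by metis
  show "\<exists>\<gamma> :: nat \<Rightarrow> real. \<forall>n\<ge>1. \<forall>\<xi> :: ellinf.
      (\<forall>k<n. apply_bcontfun \<xi> k \<in> {-1, 0, 1}) \<and> (\<forall>k\<ge>n. apply_bcontfun \<xi> k = 0) \<longrightarrow>
      (\<exists>\<eta> :: 'b \<Rightarrow>\<^sub>L real.
        cut_off n (adjoint_ell1 A \<eta>) = \<xi> \<and>
        (\<forall>k\<ge>n. \<bar>apply_bcontfun (adjoint_ell1 A \<eta> - cut_off n (adjoint_ell1 A \<eta>)) k\<bar> \<le> \<mu>) \<and>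
        norm \<eta> \<le> \<gamma> n)"
  proof (intro exI[of _ \<gamma>] allI impI)
    fix n :: nat and \<xi> :: ellinf
    assume \<xi>: "(\<forall>k<n. apply_bcontfun \<xi> k \<in> {-1, 0, 1}) \<and> (\<forall>k\<ge>n. apply_bcontfun \<xi> k = 0)"
    then have "\<bar>apply_bcontfun \<xi> k\<bar> \<le> 1" if "k < n" for k
      using that by fastforce
    with \<gamma> \<mu> obtain \<eta> :: "'b \<Rightarrow>\<^sub>L real" where \<eta>: "norm \<eta> \<le> \<gamma> n"
      "\<And>k. k < n \<Longrightarrow> adjoint_ell1 A \<eta> k = \<xi> k" "\<And>k. n \<le> k \<Longrightarrow> \<bar>adjoint_ell1 A \<eta> k\<bar> \<le> \<mu>"
      by (rule adjoint_interpolation) blast+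
    \<comment> \<open>Interpolation settles the positions below \<open>n\<close>; from
      \<open>n\<close> on both sequences vanish.\<close>
    have "cut_off n (adjoint_ell1 A \<eta>) = \<xi>"
      using \<xi> \<eta>(2) by (intro bcontfun_eqI) (auto simp: cut_off.rep_eq)
    moreover have "\<bar>apply_bcontfun (adjoint_ell1 A \<eta> - cut_off n (adjoint_ell1 A \<eta>)) k\<bar> \<le> \<mu>" if "n \<le> k" for k
      using \<eta>(3)[OF that] that by (simp add: minus_bcontfun.rep_eq cut_off.rep_eq)
    ultimately show "\<exists>\<eta> :: 'b \<Rightarrow>\<^sub>L real.
        cut_off n (adjoint_ell1 A \<eta>) = \<xi> \<and>
        (\<forall>k\<ge>n. \<bar>apply_bcontfun (adjoint_ell1 A \<eta> - cut_off n (adjoint_ell1 A \<eta>)) k\<bar> \<le> \<mu>) \<and>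
        norm \<eta> \<le> \<gamma> n"
      using \<eta>(1) by blast
  qed
qed

end
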